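(* For any closed set $e\subset\mathbb{R}$ of Lebesgue measure zero there exists a continuous function $f\in C(\mathbb{R})\cap L^1(\mathbb{R})$ such that $$H^*f(x)=\infty\quad\text{for every } x\in e.$$
   Context: For $f\in L^1(\mathbb{R})$, $x\in\mathbb{R}$ and $\varepsilon>0$ the truncated Hilbert transform is $$H_\varepsilon f(x)=\frac1\pi\int_{|t-x|>\varepsilon}\frac{f(t)}{x-t}\,dt,$$ and the maximal Hilbert transform is $H^*f(x)=\sup_{\varepsilon>0}|H_\varepsilon f(x)|\in[0,\infty]$. $C(\mathbb{R})$ is the set of continuous functions on $\mathbb{R}$. *)

theory Defs
  imports "HOL-Analysis.Analysis"
begin

(* For f integrable and eps > 0 the integrand is integrable, since the kernel is bounded by 1/eps
   on the domain of integration. So the Bochner integral never takes its default value 0. *)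
definition trunc_hilbert :: "real \<Rightarrow> (real \<Rightarrow> real) \<Rightarrow> real \<Rightarrow> real" where
  "trunc_hilbert eps f x = 1 / pi * (LINT t:{t. \<bar>t - x\<bar> > eps}|lborel. f t / (x - t))"

definition max_hilbert :: "(real \<Rightarrow> real) \<Rightarrow> real \<Rightarrow> ennreal" where
  "max_hilbert f x = (SUP eps\<in>{0<..}. ennreal \<bar>trunc_hilbert eps f x\<bar>)"

end

theory Submission
  imports Defs "HOL-Probability.Sinc_Integral"
begin

text \<open>
  The truncated Hilbert transform at scale \<open>eps\<close> is replaced by the conjugate Poisson integral
  \<open>conj_poisson eps f x\<close>, the integral of \<open>f t (x - t) / ((x - t)\<^sup>2 + eps\<^sup>2)\<close>. For \<open>f\<close> bounded by 1 it
  differs by at most \<open>pi\<close> from \<open>pi\<close> times the truncated transform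
  (\<open>trunc_hilbert_conj_poisson\<close>). So it suffices to make the conjugate Poisson integrals of a
  bounded function unbounded at every point of the given set.

  The core is a set \<open>E\<close> of small measure whose indicator has a large conjugate Poisson integral
  at all points of a compact null set \<open>K\<close> (\<open>ln_le_conj_poisson_union\<close>). Cover \<open>K\<close> by a finite
  \<open>eps\<close>-net \<open>B\<close> for which \<open>eps * card B\<close> is as small as desired (\<open>compact_null_net\<close>). The rational
  function \<open>R z = 1 + 2 A eps \<Sum>b\<in>B. 1 / (z - b)\<close> has real zeros that interlace with its poles, so it
  equals the product of the factors \<open>(z - a b) / (z - b)\<close> over disjoint intervals from \<open>a b\<close> to \<open>b\<close>
  (\<open>partial_fraction_factorization\<close>). For the union \<open>E\<close> of these intervals, the conjugate Poisson
  integral at \<open>x\<close> is exactly \<open>ln \<bar>R (x + \<i> eps)\<bar>\<close>, while the measure of \<open>E\<close> is at most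
  \<open>2 A eps * card B\<close> (\<open>total_gap_le\<close>). If \<open>x\<close> lies within \<open>eps\<close> of some pole, the imaginary part of
  \<open>R (x + \<i> eps)\<close> alone has modulus at least \<open>A\<close>. Thus \<open>A\<close> can be fixed first and the measure of \<open>E\<close>
  be made small afterwards.

  A gliding hump combines the scales. Lipschitz functions have conjugate Poisson integrals
  bounded uniformly in \<open>eps\<close> (\<open>conj_poisson_lipschitz_bounded\<close>), and a nonnegative function of integral at
  most \<open>eps\<close> contributes at most 1/2 at scale \<open>eps\<close>. Hence a Lipschitz function can be perturbed by an
  arbitrarily small nonnegative amount so that the conjugate Poisson integral exceeds any given
  bound on \<open>K\<close> at some new scale (\<open>small_perturbation_large_conj_poisson\<close>). Iterate this over the
  compact parts of the given set that lie in \<open>[- n, n]\<close>, with perturbations summable both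
  uniformly and in \<open>L\<^sup>1\<close>, and with integrals so small that they do not disturb the scales used before.
\<close>

section \<open>The conjugate Poisson integral\<close>

text \<open>
  The real part of \<open>1 / (s + \<i> eps)\<close>: the Hilbert kernel \<open>1 / s\<close> smoothed at scale \<open>eps\<close>
  instead of truncated there.
\<close>
definition conj_kernel :: "real \<Rightarrow> real \<Rightarrow> real" where
  "conj_kernel eps s = s / (s\<^sup>2 + eps\<^sup>2)"

definition conj_poisson :: "real \<Rightarrow> (real \<Rightarrow> real) \<Rightarrow> real \<Rightarrow> real" where
  "conj_poisson eps f x = (LINT t|lborel. f t * conj_kernel eps (x - t))"

lemma borel_measurable_conj_kernel [measurable]: "conj_kernel eps \<in> borel_measurable borel"
  unfolding conj_kernel_def by measurable

lemma abs_conj_kernel_le: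
  assumes "eps > 0"
  shows "\<bar>conj_kernel eps s\<bar> \<le> 1 / (2 * eps)"
proof -
  have "0 \<le> (\<bar>s\<bar> - eps)\<^sup>2" by simp
  then have "2 * eps * \<bar>s\<bar> \<le> s\<^sup>2 + eps\<^sup>2" by (simp add: power2_diff algebra_simps)
  moreover have "s\<^sup>2 + eps\<^sup>2 > 0" using assms by (simp add: add_nonneg_pos)
  ultimately show ?thesis using assms
    unfolding conj_kernel_def by (simp add: divide_simps abs_mult algebra_simps)
qed

lemma integrable_conj_poisson:
  assumes "eps > 0" "integrable lborel f"
  shows "integrable lborel (\<lambda>t. f t * conj_kernel eps (x - t))"
proof (rule Bochner_Integration.integrable_bound)
  show "integrable lborel (\<lambda>t. (1 / (2 * eps)) * f t)" using assms(2) by simp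
  have [measurable]: "f \<in> borel_measurable borel" using assms(2) by auto
  show "(\<lambda>t. f t * conj_kernel eps (x - t)) \<in> borel_measurable lborel" by measurable
  show "AE t in lborel. norm (f t * conj_kernel eps (x - t)) \<le> norm ((1 / (2 * eps)) * f t)"
  proof (rule AE_I2)
    fix t
    have "\<bar>f t\<bar> * \<bar>conj_kernel eps (x - t)\<bar> \<le> \<bar>f t\<bar> * (1 / (2 * eps))"
      by (intro mult_left_mono abs_conj_kernel_le assms) auto
    then show "norm (f t * conj_kernel eps (x - t)) \<le> norm ((1 / (2 * eps)) * f t)"
      using assms(1) by (simp add: abs_mult)
  qed
qed

lemma conj_poisson_diff:
  assumes "eps > 0" "integrable lborel f" "integrable lborel g"
  shows "conj_poisson eps (\<lambda>t. f t - g t) x = conj_poisson eps f x - conj_poisson eps g x"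
  using integrable_conj_poisson[OF assms(1,2), of x] integrable_conj_poisson[OF assms(1,3), of x]
  by (simp add: conj_poisson_def left_diff_distrib)

lemma conj_poisson_add_scaled:
  assumes "eps > 0" "integrable lborel f" "integrable lborel g"
  shows "conj_poisson eps (\<lambda>t. f t + c * g t) x = conj_poisson eps f x + c * conj_poisson eps g x"
  using integrable_conj_poisson[OF assms(1,2), of x] integrable_conj_poisson[OF assms(1,3), of x]
  by (simp add: conj_poisson_def distrib_right mult.assoc)

lemma abs_conj_poisson_le:
  assumes "eps > 0" "integrable lborel f"
  shows "\<bar>conj_poisson eps f x\<bar> \<le> (LINT t|lborel. \<bar>f t\<bar>) / (2 * eps)"
proof -
  have "\<bar>conj_poisson eps f x\<bar> \<le> (LINT t|lborel. \<bar>f t * conj_kernel eps (x - t)\<bar>)"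
    unfolding conj_poisson_def using integral_norm_bound[of lborel "\<lambda>t. f t * conj_kernel eps (x - t)"]
    by simp
  also have "\<dots> \<le> (LINT t|lborel. \<bar>f t\<bar> * (1 / (2 * eps)))"
  proof (rule integral_mono)
    show "integrable lborel (\<lambda>t. \<bar>f t * conj_kernel eps (x - t)\<bar>)"
      using integrable_conj_poisson[OF assms] by (rule integrable_abs)
    show "\<bar>f t * conj_kernel eps (x - t)\<bar> \<le> \<bar>f t\<bar> * (1 / (2 * eps))" for t
      unfolding abs_mult by (intro mult_left_mono abs_conj_kernel_le assms) auto
  qed (use assms in simp)
  finally show ?thesis by simp
qed

lemma abs_trunc_kernel_diff_le:
  assumes "eps > 0"
  shows "\<bar>indicator {t. \<bar>t\<bar> > eps} s / s - conj_kernel eps s\<bar> \<le> eps / (s\<^sup>2 + eps\<^sup>2)"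
proof -
  have p: "s\<^sup>2 + eps\<^sup>2 > 0" using assms by (simp add: add_nonneg_pos)
  show ?thesis
  proof (cases "\<bar>s\<bar> > eps")
    case True
    then have "s \<noteq> 0" using assms by auto
    then have "1 / s - conj_kernel eps s = (eps / s) * (eps / (s\<^sup>2 + eps\<^sup>2))"
      using p by (simp add: conj_kernel_def divide_simps power2_eq_square)
    then have "\<bar>1 / s - conj_kernel eps s\<bar> = \<bar>eps / s\<bar> * (eps / (s\<^sup>2 + eps\<^sup>2))"
      using assms p by (simp only: abs_mult) simp
    also have "\<dots> \<le> 1 * (eps / (s\<^sup>2 + eps\<^sup>2))"
      using True assms p by (intro mult_right_mono) (auto simp: abs_divide)
    finally show ?thesis using True by simp
  next
    case False
    then show ?thesis using p by (simp add: conj_kernel_def abs_divide divide_right_mono)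
  qed
qed

lemma has_integral_poisson_kernel:
  assumes "eps > 0"
  shows "has_bochner_integral lborel (\<lambda>t. eps / ((x - t)\<^sup>2 + eps\<^sup>2)) pi"
proof -
  have std: "has_bochner_integral lborel (\<lambda>s::real. inverse (1 + s\<^sup>2)) pi"
    using integrable_inverse_1_plus_square LBINT_inverse_1_plus_square
    by (simp add: has_bochner_integral_iff set_integrable_def interval_lebesgue_integral_def
        set_lebesgue_integral_def)
  have "has_bochner_integral lborel (\<lambda>t. inverse (1 + (x / eps + (- 1 / eps) * t)\<^sup>2)) (pi /\<^sub>R \<bar>- 1 / eps\<bar>)"
    using std assms by (subst lborel_has_bochner_integral_real_affine_iff[symmetric]) auto
  then have "has_bochner_integral lborel
      (\<lambda>t. (1 / eps) * inverse (1 + (x / eps + (- 1 / eps) * t)\<^sup>2)) ((1 / eps) * (pi /\<^sub>R \<bar>- 1 / eps\<bar>))"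
    by (rule has_bochner_integral_mult_right)
  moreover have "(1 / eps) * inverse (1 + (x / eps + (- 1 / eps) * t)\<^sup>2) = eps / ((x - t)\<^sup>2 + eps\<^sup>2)" for t
  proof -
    have "x / eps + (- 1 / eps) * t = (x - t) / eps" by (simp add: diff_divide_distrib)
    moreover have "(x - t)\<^sup>2 + eps\<^sup>2 > 0" using assms by (simp add: add_nonneg_pos)
    ultimately show ?thesis using assms
      by (simp add: power_divide divide_simps power2_eq_square)
  qed
  ultimately show ?thesis using assms by (simp add: abs_divide)
qed

text \<open>
  Truncating and smoothing the Hilbert kernel at the same scale differ by at most a Poisson kernel,
  whose integral is \<open>pi\<close> at every scale. For bounded \<open>f\<close>, the truncated transforms at a point are
  therefore unbounded as soon as the conjugate Poisson integrals are.
\<close>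
lemma trunc_hilbert_conj_poisson:
  assumes eps: "eps > 0" and f: "integrable lborel f" and M: "\<And>t. \<bar>f t\<bar> \<le> M"
  shows "\<bar>pi * trunc_hilbert eps f x - conj_poisson eps f x\<bar> \<le> pi * M"
proof -
  have [measurable]: "f \<in> borel_measurable borel" using f by auto
  define d where "d t = indicator {t. \<bar>t\<bar> > eps} (x - t) / (x - t) - conj_kernel eps (x - t)" for t
  have P: "has_bochner_integral lborel (\<lambda>t. M * (eps / ((x - t)\<^sup>2 + eps\<^sup>2))) (M * pi)"
    using has_bochner_integral_mult_right[OF has_integral_poisson_kernel[OF eps]] by simp
  have bd: "\<bar>f t * d t\<bar> \<le> M * (eps / ((x - t)\<^sup>2 + eps\<^sup>2))" for t
    unfolding d_def abs_mult
    using abs_trunc_kernel_diff_le[OF eps, of "x - t"] M[of t]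
    by (intro mult_mono) (auto intro: order_trans[OF abs_ge_zero])
  have int: "integrable lborel (\<lambda>t. f t * d t)"
  proof (rule Bochner_Integration.integrable_bound)
    show "integrable lborel (\<lambda>t. M * (eps / ((x - t)\<^sup>2 + eps\<^sup>2)))"
      using P by (simp add: has_bochner_integral_iff)
    show "(\<lambda>t. f t * d t) \<in> borel_measurable lborel" unfolding d_def by measurable
    show "AE t in lborel. norm (f t * d t) \<le> norm (M * (eps / ((x - t)\<^sup>2 + eps\<^sup>2)))"
      using bd by (intro AE_I2) (metis abs_ge_self order_trans real_norm_def)
  qed
  have "pi * trunc_hilbert eps f x = (LINT t|lborel. f t * d t + f t * conj_kernel eps (x - t))"
    unfolding trunc_hilbert_def set_lebesgue_integral_def
    by (simp add: d_def, intro Bochner_Integration.integral_cong)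
       (auto simp: algebra_simps indicator_def abs_minus_commute)
  also have "\<dots> = (LINT t|lborel. f t * d t) + conj_poisson eps f x"
    unfolding conj_poisson_def
    by (rule Bochner_Integration.integral_add[OF int integrable_conj_poisson[OF eps f]])
  finally have "\<bar>pi * trunc_hilbert eps f x - conj_poisson eps f x\<bar> = \<bar>LINT t|lborel. f t * d t\<bar>"
    by simp
  also have "\<dots> \<le> (LINT t|lborel. \<bar>f t * d t\<bar>)"
    using integral_norm_bound[of lborel "\<lambda>t. f t * d t"] by simp
  also have "\<dots> \<le> (LINT t|lborel. M * (eps / ((x - t)\<^sup>2 + eps\<^sup>2)))"
    using bd int P by (intro integral_mono) (auto simp: has_bochner_integral_iff)
  also have "\<dots> = pi * M" using P by (simp add: has_bochner_integral_iff)
  finally show ?thesis .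
qed

text \<open>
  The kernel has the antiderivative \<open>ln \<bar>s + \<i> eps\<bar>\<close>, so intervals contribute the logarithm of a ratio
  of distances to \<open>x + \<i> eps\<close>. Sums over disjoint intervals become the logarithm of the modulus of a
  rational function.
\<close>
lemma conj_poisson_interval:
  assumes "eps > 0" "a \<le> b"
  shows "conj_poisson eps (indicator {a..b}) x
           = ln (cmod (Complex x eps - of_real a)) - ln (cmod (Complex x eps - of_real b))"
    (is "_ = ?F a - ?F b")
proof -
  have F: "ln (cmod (Complex x eps - of_real t)) = ln ((x - t)\<^sup>2 + eps\<^sup>2) / 2" for t
    using assms by (simp add: cmod_def ln_sqrt add_nonneg_pos)
  have "(\<integral>t. conj_kernel eps (x - t) * indicator {a..b} t \<partial>lborel)
          = - (ln ((x - b)\<^sup>2 + eps\<^sup>2) / 2) - (- (ln ((x - a)\<^sup>2 + eps\<^sup>2) / 2))"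
  proof (rule integral_FTC_Icc_real[OF assms(2)])
    fix t
    have p: "(x - t)\<^sup>2 + eps\<^sup>2 > 0" using assms by (simp add: add_nonneg_pos)
    show "DERIV (\<lambda>t. - (ln ((x - t)\<^sup>2 + eps\<^sup>2) / 2)) t :> conj_kernel eps (x - t)"
      unfolding conj_kernel_def using p
      by (auto intro!: derivative_eq_intros simp: divide_simps) (simp_all add: algebra_simps)
    show "isCont (\<lambda>t. conj_kernel eps (x - t)) t"
      unfolding conj_kernel_def using p by (intro continuous_intros) auto
  qed
  then show ?thesis unfolding conj_poisson_def F by (simp add: mult.commute)
qed

text \<open>
  Within distance 1 of \<open>x\<close> the kernel is odd about \<open>x\<close>, so \<open>F t\<close> may be replaced by \<open>F t - F x\<close>, and the
  Lipschitz condition bounds the product of this difference with the kernel by \<open>L\<close>; further away the kernel is at most 1.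
  The bound holds uniformly in \<open>eps\<close>, so at all finer scales a Lipschitz function
  contributes only a bounded amount.
\<close>
lemma conj_poisson_lipschitz_bounded:
  assumes L: "L-lipschitz_on UNIV F" and F: "integrable lborel F" and eps: "eps > 0"
  shows "\<bar>conj_poisson eps F x\<bar> \<le> 2 * L + (LINT t|lborel. \<bar>F t\<bar>)"
proof -
  have L0: "L \<ge> 0" using L by (rule lipschitz_on_nonneg)
  have [measurable]: "F \<in> borel_measurable borel" using F by auto
  define I where "I = {x - 1..x + 1}"
  have [measurable]: "I \<in> sets borel" by (simp add: I_def)
  have Iint: "integrable lborel (indicator I :: real \<Rightarrow> real)" by (simp add: I_def)
  have kI: "integrable lborel (\<lambda>t. indicator I t * conj_kernel eps (x - t))"
    by (rule integrable_conj_poisson[OF eps Iint])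
  have zero: "(LINT t|lborel. indicator I t * conj_kernel eps (x - t)) = 0"
    using conj_poisson_interval[OF eps, of "x - 1" "x + 1" x]
    by (simp add: conj_poisson_def I_def cmod_def)
  have near: "\<bar>(F t - F x) * conj_kernel eps (x - t)\<bar> \<le> L" for t
  proof -
    have p: "(x - t)\<^sup>2 + eps\<^sup>2 > 0" using eps by (simp add: add_nonneg_pos)
    have "\<bar>F t - F x\<bar> \<le> L * \<bar>x - t\<bar>"
      using lipschitz_onD[OF L, of t x] by (simp add: dist_real_def abs_minus_commute)
    then have "\<bar>(F t - F x) * conj_kernel eps (x - t)\<bar> \<le> L * \<bar>x - t\<bar> * \<bar>conj_kernel eps (x - t)\<bar>"
      unfolding abs_mult by (rule mult_right_mono) simp
    also have "\<dots> = L * ((x - t)\<^sup>2 / ((x - t)\<^sup>2 + eps\<^sup>2))"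
      unfolding conj_kernel_def by (simp add: abs_divide power2_eq_square)
    also have "\<dots> \<le> L * 1" using p L0 by (intro mult_left_mono) auto
    finally show ?thesis by simp
  qed
  have far: "\<bar>indicator (- I) t * (F t * conj_kernel eps (x - t))\<bar> \<le> \<bar>F t\<bar>" for t
  proof (cases "t \<in> I")
    case False
    then have "1 \<le> \<bar>x - t\<bar>" by (auto simp: I_def)
    then have "\<bar>x - t\<bar> * 1 \<le> \<bar>x - t\<bar> * \<bar>x - t\<bar>" by (intro mult_left_mono) auto
    then have "\<bar>x - t\<bar> \<le> (x - t)\<^sup>2 + eps\<^sup>2" by (simp add: power2_eq_square add_increasing2)
    moreover have "(x - t)\<^sup>2 + eps\<^sup>2 > 0" using eps by (simp add: add_nonneg_pos)
    ultimately have "\<bar>conj_kernel eps (x - t)\<bar> \<le> 1"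
      unfolding conj_kernel_def by (simp add: abs_divide)
    then have "\<bar>F t\<bar> * \<bar>conj_kernel eps (x - t)\<bar> \<le> \<bar>F t\<bar> * 1" by (intro mult_left_mono) auto
    then show ?thesis using False by (simp add: abs_mult)
  qed simp
  have int1: "integrable lborel (\<lambda>t. indicator I t * ((F t - F x) * conj_kernel eps (x - t)))"
  proof (rule Bochner_Integration.integrable_bound)
    show "integrable lborel (\<lambda>t. L * indicator I t)" using Iint by simp
    show "AE t in lborel. norm (indicator I t * ((F t - F x) * conj_kernel eps (x - t))) \<le> norm (L * indicator I t)"
      using near L0 by (intro AE_I2) (auto simp: indicator_def)
  qed simp
  have int2: "integrable lborel (\<lambda>t. indicator (- I) t * (F t * conj_kernel eps (x - t)))"
    using integrable_mult_indicator[OF _ integrable_conj_poisson[OF eps F, of x], of "- I"] by simp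
  have "conj_poisson eps F x = (LINT t|lborel. indicator I t * ((F t - F x) * conj_kernel eps (x - t))
      + F x * (indicator I t * conj_kernel eps (x - t)) + indicator (- I) t * (F t * conj_kernel eps (x - t)))"
    unfolding conj_poisson_def
    by (intro Bochner_Integration.integral_cong) (auto simp: indicator_def algebra_simps)
  also have "\<dots> = (LINT t|lborel. indicator I t * ((F t - F x) * conj_kernel eps (x - t)))
      + (LINT t|lborel. indicator (- I) t * (F t * conj_kernel eps (x - t)))"
    using int1 int2 kI zero by simp
  finally have split: "\<bar>conj_poisson eps F x\<bar>
      \<le> \<bar>LINT t|lborel. indicator I t * ((F t - F x) * conj_kernel eps (x - t))\<bar>
        + \<bar>LINT t|lborel. indicator (- I) t * (F t * conj_kernel eps (x - t))\<bar>"
    by (simp only: abs_triangle_ineq)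
  have "\<bar>LINT t|lborel. indicator I t * ((F t - F x) * conj_kernel eps (x - t))\<bar>
      \<le> (LINT t|lborel. \<bar>indicator I t * ((F t - F x) * conj_kernel eps (x - t))\<bar>)"
    by (rule integral_abs_bound)
  also have "\<dots> \<le> (LINT t|lborel. L * indicator I t)"
  proof (rule integral_mono)
    show "\<bar>indicator I t * ((F t - F x) * conj_kernel eps (x - t))\<bar> \<le> L * indicator I t" for t
      using near[of t] by (simp add: indicator_def)
  qed (use integrable_abs[OF int1] Iint in auto)
  also have "\<dots> = 2 * L" by (simp add: I_def)
  finally have near': "\<bar>LINT t|lborel. indicator I t * ((F t - F x) * conj_kernel eps (x - t))\<bar> \<le> 2 * L" .
  have "\<bar>LINT t|lborel. indicator (- I) t * (F t * conj_kernel eps (x - t))\<bar>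
      \<le> (LINT t|lborel. \<bar>indicator (- I) t * (F t * conj_kernel eps (x - t))\<bar>)"
    by (rule integral_abs_bound)
  also have "\<dots> \<le> (LINT t|lborel. \<bar>F t\<bar>)"
    by (intro integral_mono integrable_abs int2 F far)
  finally show ?thesis using split near' by linarith
qed

section \<open>Interlacing zeros and poles of a rational function\<close>

text \<open>
  The polynomial here is the numerator of \<open>1 + \<alpha> \<Sum>c\<in>B. 1 / (x - c)\<close>. It changes sign between consecutive
  points of \<open>B\<close>, and also between the smallest one and a point far to the left, where the rational
  function is positive. So immediately to the left of each pole, before the preceding one,
  there is a zero.
\<close>
lemma interlacing_root:
  fixes B :: "real set" and \<alpha> :: real
  assumes fin: "finite B" and \<alpha>: "\<alpha> > 0" and b: "b \<in> B"
  shows "\<exists>a<b. (\<Prod>c\<in>B. a - c) + \<alpha> * (\<Sum>c\<in>B. \<Prod>d\<in>B - {c}. a - d) = 0 \<and> (\<forall>c\<in>B. c < b \<longrightarrow> c < a)"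
proof -
  define F where "F x = (\<Prod>c\<in>B. x - c) + \<alpha> * (\<Sum>c\<in>B. \<Prod>d\<in>B - {c}. x - d)" for x :: real
  have cont: "continuous_on S F" for S
    unfolding F_def by (intro continuous_intros)
  have root: "\<exists>a. p < a \<and> a < b \<and> F a = 0" if p: "p < b" "F p * F b < 0" for p
  proof -
    consider "F p \<le> 0 \<and> 0 \<le> F b" | "F b \<le> 0 \<and> 0 \<le> F p" using p(2) by (auto simp: mult_less_0_iff)
    then obtain a where a: "p \<le> a" "a \<le> b" "F a = 0"
      using IVT'[of F p 0 b] IVT2'[of F b 0 p] p(1) cont by cases auto
    moreover have "a \<noteq> p" "a \<noteq> b" using a(3) p(2) by auto
    ultimately show ?thesis by (auto simp: less_le)
  qed
  have F_pole: "F c = \<alpha> * (\<Prod>d\<in>B - {c}. c - d)" if c: "c \<in> B" for c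
  proof -
    have "(\<Sum>c'\<in>B. \<Prod>d\<in>B - {c'}. c - d) = (\<Sum>c'\<in>{c}. \<Prod>d\<in>B - {c'}. c - d)"
      using fin c by (intro sum.mono_neutral_right) (auto intro!: prod_zero)
    moreover have "(\<Prod>c'\<in>B. c - c') = 0" using fin c by (auto intro!: prod_zero)
    ultimately show ?thesis by (simp add: F_def)
  qed
  have split: "(\<Prod>d\<in>B. p - d) = (p - b) * (\<Prod>d\<in>B - {b}. p - d)" for p
    using fin b by (simp add: prod.remove)
  show ?thesis
  proof (cases "\<exists>c\<in>B. c < b")
    case True
    define c where "c = Max {c\<in>B. c < b}"
    have "c \<in> {c\<in>B. c < b}" unfolding c_def using True fin by (intro Max_in) auto
    then have c: "c \<in> B" "c < b" by auto
    have max: "d \<le> c" if "d \<in> B" "d < b" for d using that fin by (simp add: c_def)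
    define X where "X = (\<Prod>d\<in>B - {b} - {c}. c - d)"
    define Y where "Y = (\<Prod>d\<in>B - {b} - {c}. b - d)"
    have "(\<Prod>d\<in>B - {c}. c - d) = (c - b) * (\<Prod>d\<in>B - {c} - {b}. c - d)"
      using fin b c by (intro prod.remove) auto
    moreover have "B - {c} - {b} = B - {b} - {c}" by auto
    ultimately have Fc: "F c = \<alpha> * ((c - b) * X)" using F_pole[OF c(1)] by (simp add: X_def)
    have "(\<Prod>d\<in>B - {b}. b - d) = (b - c) * Y"
      unfolding Y_def using fin b c by (intro prod.remove) auto
    then have Fb: "F b = \<alpha> * ((b - c) * Y)" using F_pole[OF b] by simp
    have "(\<Prod>d\<in>B - {b} - {c}. (c - d) * (b - d)) = X * Y"
      by (simp add: X_def Y_def prod.distrib)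
    then have "F c * F b = - ((\<alpha> * (b - c))\<^sup>2 * (\<Prod>d\<in>B - {b} - {c}. (c - d) * (b - d)))"
      by (simp add: Fc Fb power2_eq_square algebra_simps)
    moreover have "(\<Prod>d\<in>B - {b} - {c}. (c - d) * (b - d)) > 0"
    proof (rule prod_pos)
      fix d assume "d \<in> B - {b} - {c}"
      then have d: "d \<in> B" "d \<noteq> b" "d \<noteq> c" by auto
      show "0 < (c - d) * (b - d)"
        using d max[of d] c(2) by (cases "d < b") (auto intro: mult_pos_pos mult_neg_neg)
    qed
    moreover have "(\<alpha> * (b - c))\<^sup>2 > 0" using \<alpha> c(2) by simp
    ultimately have "F c * F b < 0" by simp
    from root[OF c(2) this] obtain a where "c < a" "a < b" "F a = 0" by auto
    then show ?thesis using max unfolding F_def by (intro exI[of _ a]) force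
  next
    case False
    then have bmin: "b \<le> c" if "c \<in> B" for c using that by force
    \<comment> \<open>This far left, the sum over the poles is larger than \<open>- 1 / \<alpha>\<close>.\<close>
    define p where "p = b - (\<alpha> * card B + 1)"
    have n0: "\<alpha> * card B \<ge> 0" using \<alpha> by simp
    have p: "p < b" using n0 by (simp add: p_def)
    have nz: "p - c \<noteq> 0" if "c \<in> B" for c using bmin[OF that] p by auto
    have "(\<Sum>c\<in>B. inverse (c - p)) \<le> (\<Sum>c\<in>B. inverse (\<alpha> * card B + 1))"
      using bmin n0 by (intro sum_mono le_imp_inverse_le) (auto simp: p_def)
    then have "\<alpha> * (\<Sum>c\<in>B. inverse (c - p)) \<le> \<alpha> * (card B * inverse (\<alpha> * card B + 1))"
      using \<alpha> by (intro mult_left_mono) auto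
    also have "\<dots> < 1"
      using n0 by (simp add: field_simps)
    finally have R: "1 - \<alpha> * (\<Sum>c\<in>B. inverse (c - p)) > 0" by simp
    have "(\<Prod>d\<in>B - {c}. p - d) = - ((\<Prod>d\<in>B. p - d) * inverse (c - p))" if "c \<in> B" for c
      using prod.remove[OF fin that, of "\<lambda>d. p - d"] nz[OF that] by (simp add: field_simps)
    then have "(\<Sum>c\<in>B. \<Prod>d\<in>B - {c}. p - d) = - ((\<Prod>d\<in>B. p - d) * (\<Sum>c\<in>B. inverse (c - p)))"
      by (simp add: sum_negf sum_distrib_left)
    then have "F p = (\<Prod>d\<in>B. p - d) * (1 - \<alpha> * (\<Sum>c\<in>B. inverse (c - p)))"
      by (simp add: F_def algebra_simps)
    also have "\<dots> = - ((b - p) * (1 - \<alpha> * (\<Sum>c\<in>B. inverse (c - p))) * (\<Prod>d\<in>B - {b}. p - d))"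
      unfolding split by (simp add: algebra_simps)
    finally have "F p * F b = - (\<alpha> * (b - p) * (1 - \<alpha> * (\<Sum>c\<in>B. inverse (c - p)))
        * (\<Prod>d\<in>B - {b}. (p - d) * (b - d)))"
      unfolding F_pole[OF b] prod.distrib by simp
    moreover have "(\<Prod>d\<in>B - {b}. (p - d) * (b - d)) > 0"
    proof (rule prod_pos)
      fix d assume "d \<in> B - {b}"
      then show "0 < (p - d) * (b - d)"
        using bmin[of d] p by (intro mult_neg_neg) auto
    qed
    ultimately have "F p * F b < 0"
      using \<alpha> p R by simp
    from root[OF p this] obtain a where "p < a" "a < b" "F a = 0" by auto
    then show ?thesis using False unfolding F_def by (intro exI[of _ a]) force
  qed
qed

text \<open>
  The interlacing zeros are \<open>card B\<close> distinct roots of a monic polynomial of degree \<open>card B\<close>, hence all of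
  its roots.
\<close>
lemma partial_fraction_factorization:
  fixes B :: "real set" and \<alpha> :: real
  assumes fin: "finite B" and \<alpha>: "\<alpha> > 0"
  obtains a :: "real \<Rightarrow> real" where
    "\<And>b. b \<in> B \<Longrightarrow> a b < b"
    "\<And>b c. b \<in> B \<Longrightarrow> c \<in> B \<Longrightarrow> c < b \<Longrightarrow> c < a b"
    "\<And>z :: complex. z \<notin> of_real ` B \<Longrightarrow>
       (\<Prod>b\<in>B. (z - of_real (a b)) / (z - of_real b)) = 1 + of_real \<alpha> * (\<Sum>b\<in>B. 1 / (z - of_real b))"
proof -
  obtain a where a: "\<And>b. b \<in> B \<Longrightarrow> a b < b"
      "\<And>b. b \<in> B \<Longrightarrow> (\<Prod>c\<in>B. a b - c) + \<alpha> * (\<Sum>c\<in>B. \<Prod>d\<in>B - {c}. a b - d) = 0"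
      "\<And>b c. b \<in> B \<Longrightarrow> c \<in> B \<Longrightarrow> c < b \<Longrightarrow> c < a b"
    using interlacing_root[OF fin \<alpha>] by metis
  define P where "P = (\<Prod>b\<in>B. [:- complex_of_real (a b), 1:])"
  define P0 where "P0 = (\<Prod>b\<in>B. [:- complex_of_real b, 1:])"
  define Q where "Q = smult (of_real \<alpha>) (\<Sum>c\<in>B. \<Prod>d\<in>B - {c}. [:- complex_of_real d, 1:])"
  have inj: "inj_on a B"
  proof (rule linorder_inj_onI')
    fix b c assume "b \<in> B" "c \<in> B" "b < c"
    then show "a b \<noteq> a c" using a(1)[of b] a(3)[of c b] by auto
  qed
  have degP: "degree P = card B" "degree P0 = card B"
    by (simp_all add: P_def P0_def degree_prod_sum_eq)
  have leadP: "coeff P (card B) = 1" "coeff P0 (card B) = 1"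
    using lead_coeff_prod[of "\<lambda>b. [:- complex_of_real (a b), 1:]" B]
      lead_coeff_prod[of "\<lambda>b. [:- complex_of_real b, 1:]" B] degP by (simp_all add: P_def P0_def)
  have degQ: "degree (\<Prod>d\<in>B - {c}. [:- complex_of_real d, 1:]) < card B" if "c \<in> B" for c
    using fin that card_Diff1_less[OF fin that] by (simp add: degree_prod_sum_eq)
  have Q0: "coeff Q (card B) = 0"
    by (simp add: Q_def coeff_sum coeff_eq_0 degQ)
  have "degree Q \<le> card B"
    unfolding Q_def using fin degQ
    by (intro order_trans[OF degree_smult_le] degree_sum_le less_imp_le)
  then have "P = P0 + Q"
  proof (intro poly_eqI_degree_lead_coeff[where n = "card B" and A = "of_real ` a ` B"])
    show "card B \<le> card (complex_of_real ` a ` B)"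
      using inj by (simp add: card_image inj_on_def)
    fix z assume "z \<in> complex_of_real ` a ` B"
    then obtain b where b: "b \<in> B" "z = of_real (a b)" by auto
    have "poly P z = 0" using b fin by (auto simp: P_def poly_prod intro!: prod_zero)
    moreover have "poly (P0 + Q) z
        = of_real ((\<Prod>c\<in>B. a b - c) + \<alpha> * (\<Sum>c\<in>B. \<Prod>d\<in>B - {c}. a b - d))"
      by (simp add: P0_def Q_def b(2) poly_prod poly_sum)
    ultimately show "poly P z = poly (P0 + Q) z" using a(2)[OF b(1)] by simp
  qed (auto simp: degP leadP Q0 intro: degree_add_le)
  then have eq: "(\<Prod>b\<in>B. z - of_real (a b))
      = (\<Prod>b\<in>B. z - of_real b) + of_real \<alpha> * (\<Sum>c\<in>B. \<Prod>d\<in>B - {c}. z - of_real d)" for z :: complex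
    by (auto simp: P_def P0_def Q_def poly_prod poly_sum dest!: arg_cong[where f = "\<lambda>p. poly p z"])
  show thesis
  proof (rule that[OF a(1) a(3)])
    fix z :: complex assume z: "z \<notin> of_real ` B"
    then have nz: "z - of_real b \<noteq> 0" if "b \<in> B" for b using that by auto
    then have nzp: "(\<Prod>b\<in>B. z - of_real b) \<noteq> 0" using fin by auto
    have "(\<Prod>d\<in>B - {c}. z - of_real d) = (\<Prod>b\<in>B. z - of_real b) * (1 / (z - of_real c))"
      if "c \<in> B" for c
      using prod.remove[OF fin that, of "\<lambda>d. z - of_real d"] nz[OF that] by simp
    then have "(\<Prod>b\<in>B. z - of_real (a b))
        = (\<Prod>b\<in>B. z - of_real b) * (1 + of_real \<alpha> * (\<Sum>b\<in>B. 1 / (z - of_real b)))"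
      unfolding eq by (simp add: sum_distrib_left algebra_simps)
    then show "(\<Prod>b\<in>B. (z - of_real (a b)) / (z - of_real b))
        = 1 + of_real \<alpha> * (\<Sum>b\<in>B. 1 / (z - of_real b))"
      using nzp by (simp add: prod_dividef)
  qed auto
qed

lemma one_plus_sum_le_prod:
  fixes u :: "'a \<Rightarrow> real"
  assumes "\<And>i. i \<in> I \<Longrightarrow> u i \<ge> 0"
  shows "1 + (\<Sum>i\<in>I. u i) \<le> (\<Prod>i\<in>I. 1 + u i)"
  using assms
proof (induction I rule: infinite_finite_induct)
  case (insert i I)
  then have "(1 + u i) * (1 + (\<Sum>i\<in>I. u i)) \<le> (1 + u i) * (\<Prod>i\<in>I. 1 + u i)"
    by (intro mult_left_mono) auto
  moreover have "u i * (\<Sum>i\<in>I. u i) \<ge> 0"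
    using insert by (intro mult_nonneg_nonneg sum_nonneg) auto
  ultimately show ?case using insert by (simp add: algebra_simps)
qed auto

text \<open>
  Compare the coefficients of \<open>1 / x\<close> on both sides of the factorization as \<open>x\<close> tends to infinity. They
  in fact agree, but one inequality suffices, and expanding the product only to first order
  yields it.
\<close>
lemma total_gap_le:
  fixes B :: "real set" and \<alpha> :: real
  assumes fin: "finite B" and ab: "\<And>b. b \<in> B \<Longrightarrow> a b < b"
    and fac: "\<And>z :: complex. z \<notin> of_real ` B \<Longrightarrow>
       (\<Prod>b\<in>B. (z - of_real (a b)) / (z - of_real b)) = 1 + of_real \<alpha> * (\<Sum>b\<in>B. 1 / (z - of_real b))"
  shows "(\<Sum>b\<in>B. b - a b) \<le> \<alpha> * card B"
proof -
  have lim: "((\<lambda>x. \<Sum>b\<in>B. c b * (x / (x - b))) \<longlongrightarrow> (\<Sum>b\<in>B. c b * 1)) at_top" for c :: "real \<Rightarrow> real"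
  proof (intro tendsto_sum tendsto_mult tendsto_const)
    show "((\<lambda>x. x / (x - b)) \<longlongrightarrow> 1) at_top" for b :: real by real_asymp
  qed
  have "eventually (\<lambda>x. \<forall>b\<in>B. b < x) at_top"
    using fin by (intro eventually_ball_finite) (auto intro: eventually_gt_at_top)
  then have "eventually (\<lambda>x. (\<Sum>b\<in>B. (b - a b) * (x / (x - b))) \<le> (\<Sum>b\<in>B. \<alpha> * (x / (x - b)))) at_top"
    using eventually_gt_at_top[of 0]
  proof eventually_elim
    case (elim x)
    have "1 + (\<Sum>b\<in>B. (b - a b) / (x - b)) \<le> (\<Prod>b\<in>B. 1 + (b - a b) / (x - b))"
      using elim ab by (intro one_plus_sum_le_prod) (auto intro!: divide_nonneg_pos less_imp_le)
    also have "\<dots> = (\<Prod>b\<in>B. (x - a b) / (x - b))"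
      using elim by (intro prod.cong) (auto simp: field_simps)
    also have "complex_of_real \<dots> = of_real (1 + \<alpha> * (\<Sum>b\<in>B. 1 / (x - b)))"
      using fac[of "of_real x"] elim by (auto simp: image_iff)
    then have "(\<Prod>b\<in>B. (x - a b) / (x - b)) = 1 + \<alpha> * (\<Sum>b\<in>B. 1 / (x - b))"
      unfolding of_real_eq_iff .
    finally have "(\<Sum>b\<in>B. (b - a b) / (x - b)) * x \<le> \<alpha> * (\<Sum>b\<in>B. 1 / (x - b)) * x"
      using elim by (intro mult_right_mono) auto
    then show ?case by (simp add: sum_distrib_left sum_distrib_right mult.commute mult.left_commute)
  qed
  from tendsto_le[OF _ lim lim this] show ?thesis by (simp add: mult.commute)
qed

section \<open>A small set with a large conjugate Poisson integral\<close>

text \<open>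
  Take \<open>E\<close> to be the union of the intervals from each zero of \<open>R z = 1 + \<alpha> \<Sum>b\<in>B. 1 / (z - b)\<close> to the next
  pole, with \<open>\<alpha> = 2 A eps\<close>. The conjugate Poisson integral of its indicator at \<open>x\<close> is
  \<open>ln \<bar>R (x + \<i> eps)\<bar>\<close>. The imaginary parts of all terms of \<open>R (x + \<i> eps)\<close> have the same sign, so there
  is no cancellation, and one pole within distance \<open>eps\<close> of \<open>x\<close> already gives modulus at least
  \<open>\<alpha> / (2 eps) = A\<close>.
\<close>
lemma ln_le_conj_poisson_union:
  fixes B :: "real set" and A eps :: real
  assumes fin: "finite B" and eps: "eps > 0" and A: "A > 0"
  obtains E where "open E" "emeasure lborel E \<le> ennreal (2 * A * (eps * card B))"
    "\<And>x b. b \<in> B \<Longrightarrow> \<bar>x - b\<bar> \<le> eps \<Longrightarrow> ln A \<le> conj_poisson eps (indicator E) x"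
proof -
  define \<alpha> where "\<alpha> = 2 * A * eps"
  have \<alpha>: "\<alpha> > 0" using A eps by (simp add: \<alpha>_def)
  obtain a where ab: "\<And>b. b \<in> B \<Longrightarrow> a b < b"
    and sep: "\<And>b c. b \<in> B \<Longrightarrow> c \<in> B \<Longrightarrow> c < b \<Longrightarrow> c < a b"
    and fac: "\<And>z :: complex. z \<notin> of_real ` B \<Longrightarrow>
       (\<Prod>b\<in>B. (z - of_real (a b)) / (z - of_real b)) = 1 + of_real \<alpha> * (\<Sum>b\<in>B. 1 / (z - of_real b))"
    using partial_fraction_factorization[OF fin \<alpha>] by blast
  define J where "J b = {a b<..<b}" for b
  have disj: "disjoint_family_on J B"
  proof -
    have "J b \<inter> J c = {}" if "b \<in> B" "c \<in> B" "c < b" for b c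
      using sep[OF that] by (auto simp: J_def)
    then show ?thesis unfolding disjoint_family_on_def by (metis inf_commute linorder_neqE)
  qed
  define E where "E = (\<Union>b\<in>B. J b)"
  show thesis
  proof (rule that)
    show "open E" by (auto simp: E_def J_def)
    have "emeasure lborel E = (\<Sum>b\<in>B. emeasure lborel (J b))"
      unfolding E_def by (rule sum_emeasure[symmetric, OF _ disj fin]) (auto simp: J_def)
    also have "\<dots> = ennreal (\<Sum>b\<in>B. b - a b)"
      using ab by (subst sum_ennreal[symmetric]) (auto simp: J_def less_imp_le)
    also have "\<dots> \<le> ennreal (2 * A * (eps * card B))"
      using total_gap_le[OF fin ab fac] by (intro ennreal_leI) (simp add: \<alpha>_def mult.assoc)
    finally show "emeasure lborel E \<le> ennreal (2 * A * (eps * card B))" .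
  next
    fix x c assume c: "c \<in> B" "\<bar>x - c\<bar> \<le> eps"
    define z where "z = Complex x eps"
    have z: "z \<notin> of_real ` B" using eps by (auto simp: z_def complex_eq_iff)
    have nz: "z - of_real t \<noteq> 0" for t using eps by (auto simp: z_def complex_eq_iff)
    have J: "conj_poisson eps (indicator (J b)) x = ln (cmod (z - of_real (a b))) - ln (cmod (z - of_real b))"
      if "b \<in> B" for b
    proof -
      have "AE t in lborel. indicator (J b) t * conj_kernel eps (x - t)
          = indicator {a b..b} t * conj_kernel eps (x - t)"
        using AE_lborel_singleton[of "a b"] AE_lborel_singleton[of b]
        by eventually_elim (auto simp: J_def indicator_def)
      then have "conj_poisson eps (indicator (J b)) x = conj_poisson eps (indicator {a b..b}) x"
        unfolding conj_poisson_def by (intro integral_cong_AE) (auto simp: J_def)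
      then show ?thesis
        using conj_poisson_interval[OF eps less_imp_le[OF ab[OF that]], of x] by (simp add: z_def)
    qed
    have Jint: "integrable lborel (\<lambda>t. indicator (J b) t * conj_kernel eps (x - t))" for b
      by (intro integrable_conj_poisson eps) (cases "a b \<le> b"; simp add: J_def)
    have "indicator E t * conj_kernel eps (x - t) = (\<Sum>b\<in>B. indicator (J b) t * conj_kernel eps (x - t))" for t
      unfolding E_def by (simp add: indicator_UN_disjoint[OF fin disj] sum_distrib_right)
    then have "conj_poisson eps (indicator E) x = (\<Sum>b\<in>B. conj_poisson eps (indicator (J b)) x)"
      unfolding conj_poisson_def using Jint by simp
    also have "\<dots> = (\<Sum>b\<in>B. ln (cmod ((z - of_real (a b)) / (z - of_real b))))"
      using J nz by (intro sum.cong) (simp_all add: norm_divide ln_div)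
    also have "\<dots> = ln (\<Prod>b\<in>B. cmod ((z - of_real (a b)) / (z - of_real b)))"
      using nz fin by (intro ln_prod[symmetric]) auto
    also have "\<dots> = ln (cmod (1 + of_real \<alpha> * (\<Sum>b\<in>B. 1 / (z - of_real b))))"
      using fac[OF z] by (simp add: prod_norm)
    also have "\<dots> \<ge> ln A"
    proof (rule ln_mono)
      have im: "Im (1 / (z - of_real b)) = - (eps / ((x - b)\<^sup>2 + eps\<^sup>2))" for b
        by (simp add: z_def Im_divide)
      have pos: "(x - b)\<^sup>2 + eps\<^sup>2 > 0" for b using eps by (simp add: add_nonneg_pos)
      have "(x - c)\<^sup>2 \<le> eps\<^sup>2" using c(2) eps by (simp add: abs_le_square_iff[symmetric])
      then have "eps / (2 * eps\<^sup>2) \<le> eps / ((x - c)\<^sup>2 + eps\<^sup>2)"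
        using eps pos by (intro divide_left_mono) auto
      also have "\<dots> \<le> (\<Sum>b\<in>B. eps / ((x - b)\<^sup>2 + eps\<^sup>2))"
        using fin c(1) eps pos by (intro member_le_sum) (auto intro: divide_nonneg_pos)
      finally have "\<alpha> * (eps / (2 * eps\<^sup>2)) \<le> \<alpha> * (\<Sum>b\<in>B. eps / ((x - b)\<^sup>2 + eps\<^sup>2))"
        using \<alpha> by (intro mult_left_mono) auto
      also have "\<alpha> * (eps / (2 * eps\<^sup>2)) = A" using eps by (simp add: \<alpha>_def power2_eq_square)
      also have "\<alpha> * (\<Sum>b\<in>B. eps / ((x - b)\<^sup>2 + eps\<^sup>2))
          = - Im (1 + of_real \<alpha> * (\<Sum>b\<in>B. 1 / (z - of_real b)))"
        unfolding plus_complex.sel Im_complex_of_real times_complex.sel Im_sum im by (simp add: sum_negf)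
      also have "\<dots> \<le> cmod (1 + of_real \<alpha> * (\<Sum>b\<in>B. 1 / (z - of_real b)))"
        using abs_Im_le_cmod abs_le_D2 by blast
      finally show "A \<le> cmod (1 + of_real \<alpha> * (\<Sum>b\<in>B. 1 / (z - of_real b)))" .
    qed (use A in auto)
    finally show "ln A \<le> conj_poisson eps (indicator E) x" .
  qed
qed

text \<open>
  The grid cells of side \<open>eps\<close> that meet \<open>K\<close> are disjoint and, for small \<open>eps\<close>, contained in a given
  neighbourhood of \<open>K\<close>, which can be chosen of measure below \<open>\<eta>\<close>. Hence their number times \<open>eps\<close> is below
  \<open>\<eta>\<close>. The left endpoints of the cells form the net.
\<close>
lemma compact_null_net:
  fixes K :: "real set" and \<eta> :: real
  assumes K: "compact K" "emeasure lborel K = 0" and \<eta>: "\<eta> > 0"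
  obtains B eps where "finite B" "0 < eps" "eps < \<eta>" "eps * card B < \<eta>"
    "\<And>x. x \<in> K \<Longrightarrow> \<exists>b\<in>B. \<bar>x - b\<bar> \<le> eps"
proof (cases "K = {}")
  case True
  show thesis by (rule that[of "{}" "\<eta> / 2"]) (use True \<eta> in auto)
next
  case False
  have Kb: "K \<in> sets borel" using K(1) by (simp add: compact_imp_closed)
  obtain U where U: "open U" "K \<subseteq> U" "emeasure lborel (U - K) < ennreal \<eta>"
    using outer_regular_lborel[OF Kb, of \<eta>] \<eta> by auto
  have "emeasure lborel U \<le> emeasure lborel (U - K) + emeasure lborel K"
    using U Kb by (intro order_trans[OF _ emeasure_subadditive] emeasure_mono) auto
  then have mU: "emeasure lborel U < ennreal \<eta>" using U(3) K(2) by simp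
  obtain d where d: "d > 0" "{x. infdist x K \<le> d} \<subseteq> U"
    using compact_in_open_separated[OF False K(1) U(1,2)] by blast
  define eps where "eps = min d (\<eta> / 2)"
  have eps: "0 < eps" "eps \<le> d" "eps < \<eta>" using d(1) \<eta> by (auto simp: eps_def)
  define Z where "Z = (\<lambda>x. \<lfloor>x / eps\<rfloor>) ` K"
  define J where "J k = {eps * real_of_int k..<eps * (real_of_int k + 1)}" for k
  have mem: "x \<in> J \<lfloor>x / eps\<rfloor>" for x
    using floor_divide_lower[OF eps(1), of x] floor_divide_upper[OF eps(1), of x]
    by (simp add: J_def mult.commute)
  have JU: "J k \<subseteq> U" if "k \<in> Z" for k
  proof
    fix y assume y: "y \<in> J k"
    obtain x where x: "x \<in> K" "k = \<lfloor>x / eps\<rfloor>" using \<open>k \<in> Z\<close> by (auto simp: Z_def)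
    have "dist y x \<le> eps" using y mem[of x] x(2) by (auto simp: J_def dist_real_def algebra_simps)
    then have "infdist y K \<le> d" using infdist_le[OF x(1), of y] eps by linarith
    then show "y \<in> U" using d(2) by auto
  qed
  have finZ: "finite Z"
  proof -
    obtain r where r: "\<And>x. x \<in> K \<Longrightarrow> \<bar>x\<bar> \<le> r"
      using compact_imp_bounded[OF K(1)] by (auto simp: bounded_iff)
    have "Z \<subseteq> {\<lfloor>- r / eps\<rfloor>..\<lfloor>r / eps\<rfloor>}"
    proof
      fix k assume "k \<in> Z"
      then obtain x where x: "x \<in> K" "k = \<lfloor>x / eps\<rfloor>" by (auto simp: Z_def)
      have "- r / eps \<le> x / eps" "x / eps \<le> r / eps"
        using r[OF x(1)] eps(1) by (intro divide_right_mono; simp)+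
      then show "k \<in> {\<lfloor>- r / eps\<rfloor>..\<lfloor>r / eps\<rfloor>}" unfolding x(2) by (simp only: floor_mono atLeastAtMost_iff)
    qed
    then show ?thesis by (rule finite_subset) simp
  qed
  have disj: "disjoint_family_on J Z"
  proof -
    have "k = l" if "y \<in> J k" "y \<in> J l" for y k l
    proof -
      have "\<lfloor>y / eps\<rfloor> = m" if "y \<in> J m" for m
        using that eps(1) by (intro floor_unique) (auto simp: J_def field_simps)
      then show ?thesis using that by auto
    qed
    then show ?thesis by (auto simp: disjoint_family_on_def)
  qed
  have "(\<Sum>k\<in>Z. emeasure lborel (J k)) = emeasure lborel (\<Union>k\<in>Z. J k)"
    by (rule sum_emeasure[OF _ disj finZ]) (auto simp: J_def)
  also have "\<dots> \<le> emeasure lborel U" using JU U(1) by (intro emeasure_mono) auto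
  also have "(\<Sum>k\<in>Z. emeasure lborel (J k)) = (\<Sum>k\<in>Z. ennreal eps)"
    using eps(1) by (intro sum.cong) (auto simp: J_def algebra_simps)
  also have "\<dots> = ennreal (eps * card Z)"
    using eps(1) by (simp add: ennreal_of_nat_eq_real_of_nat ennreal_mult' mult.commute)
  finally have cZ: "eps * card Z < \<eta>" using mU by (metis le_less_trans ennreal_less_iff eps(1) less_imp_le mult_nonneg_nonneg of_nat_0_le_iff)
  define B where "B = (\<lambda>k. eps * real_of_int k) ` Z"
  have "card B \<le> card Z" unfolding B_def using finZ by (rule card_image_le)
  then have "eps * card B \<le> eps * card Z" using eps(1) by (intro mult_left_mono) auto
  then have cB: "eps * card B < \<eta>" using cZ by linarith
  show thesis
  proof (rule that[OF _ eps(1,3) cB])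
    show "finite B" using finZ by (simp add: B_def)
    fix x assume "x \<in> K"
    then have "eps * real_of_int \<lfloor>x / eps\<rfloor> \<in> B" by (auto simp: B_def Z_def)
    then show "\<exists>b\<in>B. \<bar>x - b\<bar> \<le> eps"
      using mem[of x] by (intro bexI) (auto simp: J_def algebra_simps)
  qed
qed

text \<open>
  The ramps \<open>min 1 (n * infdist t (- E))\<close> increase to the indicator of the open set \<open>E\<close>.
\<close>
lemma lipschitz_inner_approximation:
  fixes E :: "real set"
  assumes E: "open E" "emeasure lborel E < \<infinity>" and \<eta>: "\<eta> > 0"
  obtains g L where "L-lipschitz_on UNIV g" "integrable lborel g"
    "\<And>t. 0 \<le> g t" "\<And>t. g t \<le> indicator E t"
    "(LINT t|lborel. indicat_real E t - g t) < \<eta>"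
proof -
  have Eint: "integrable lborel (indicator E :: real \<Rightarrow> real)" using E by simp
  have ne: "- E \<noteq> {}"
  proof
    assume "- E = {}"
    then have "E = UNIV" by auto
    then show False using E(2) by simp
  qed
  have cl: "closed (- E)" using E(1) by (simp add: closed_Compl)
  define g where "g n t = min 1 (real n * infdist t (- E))" for n :: nat and t
  have g0: "0 \<le> g n t" for n t by (simp add: g_def infdist_nonneg)
  have gE: "g n t \<le> indicator E t" for n t
    by (cases "t \<in> E") (auto simp: g_def)
  have lip: "(real n)-lipschitz_on UNIV (g n)" for n
  proof (rule lipschitz_onI)
    fix s t
    have "\<bar>g n s - g n t\<bar> \<le> \<bar>real n * infdist s (- E) - real n * infdist t (- E)\<bar>"
      by (simp add: g_def min_def)
    also have "\<dots> = real n * \<bar>infdist s (- E) - infdist t (- E)\<bar>"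
      by (simp add: abs_mult flip: right_diff_distrib)
    also have "\<dots> \<le> real n * dist s t" by (intro mult_left_mono infdist_triangle_abs) auto
    finally show "dist (g n s) (g n t) \<le> real n * dist s t" by (simp add: dist_real_def)
  qed auto
  have meas: "g n \<in> borel_measurable lborel" for n
    using lipschitz_on_continuous_on[OF lip] by (simp add: borel_measurable_continuous_onI)
  have bd: "norm (g n t) \<le> indicator E t" for n t using g0[of n t] gE[of n t] by simp
  have conv: "(\<lambda>n. g n t) \<longlonglongrightarrow> indicator E t" for t
  proof (cases "t \<in> E")
    case True
    then have p: "infdist t (- E) > 0" using infdist_pos_not_in_closed[OF cl ne, of t] by auto
    then obtain N where "1 / infdist t (- E) < real N" using reals_Archimedean2 by blast
    then have "1 < real N * infdist t (- E)" using p by (simp add: field_simps)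
    moreover have "real N * infdist t (- E) \<le> real n * infdist t (- E)" if "n \<ge> N" for n
      using that p by (intro mult_right_mono) auto
    ultimately have "g n t = 1" if "n \<ge> N" for n using that unfolding g_def by fastforce
    then have "eventually (\<lambda>n. g n t = 1) sequentially" by (auto simp: eventually_sequentially)
    then show ?thesis using True by (simp add: tendsto_eventually)
  qed (auto simp: g_def)
  have gint: "integrable lborel (g n)" for n
    by (rule Bochner_Integration.integrable_bound[OF Eint meas]) (use bd in auto)
  have "(\<lambda>n. LINT t|lborel. g n t) \<longlonglongrightarrow> (LINT t|lborel. indicat_real E t)"
    by (rule integral_dominated_convergence[where w = "indicator E"]) (use Eint meas conv bd in auto)
  then have "eventually (\<lambda>n. (LINT t|lborel. indicat_real E t) - \<eta> < (LINT t|lborel. g n t)) sequentially"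
    using \<eta> by (intro order_tendstoD) auto
  then obtain n where "(LINT t|lborel. indicat_real E t) - \<eta> < (LINT t|lborel. g n t)"
    by (auto simp: eventually_sequentially)
  then have "(LINT t|lborel. indicat_real E t - g n t) < \<eta>"
    using Eint gint by (subst Bochner_Integration.integral_diff) auto
  then show thesis using that[OF lip gint g0 gE] by blast
qed

text \<open>
  The set \<open>E\<close> built over a fine net of \<open>K\<close> has measure at most 1 although \<open>\<eta> ln A\<close> is large enough
  to exceed \<open>M\<close> by a bound for the contribution of \<open>F\<close>. So \<open>\<eta>\<close> times a Lipschitz approximation of its
  indicator is an admissible perturbation. The approximation costs at most 1 in the conjugate
  Poisson integral, because its \<open>L\<^sup>1\<close> distance to the indicator is chosen after \<open>eps\<close>.
\<close>
lemma small_perturbation_large_conj_poisson: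
  fixes K :: "real set" and \<eta> :: real
  assumes lip: "L-lipschitz_on UNIV F" and F: "integrable lborel F"
    and K: "compact K" "emeasure lborel K = 0" and \<eta>: "\<eta> > 0"
  obtains G L' eps where "L'-lipschitz_on UNIV G" "integrable lborel G"
    "\<And>t. F t \<le> G t" "\<And>t. G t \<le> F t + \<eta>" "(LINT t|lborel. G t - F t) \<le> \<eta>"
    "0 < eps" "eps \<le> \<eta>" "\<And>x. x \<in> K \<Longrightarrow> M \<le> conj_poisson eps G x"
proof -
  define C where "C = 2 * L + (LINT t|lborel. \<bar>F t\<bar>)"
  \<comment> \<open>\<open>\<eta> ln A\<close> has to cover the target \<open>M\<close>, the loss \<open>C\<close> from \<open>F\<close> and the loss 1 from the approximation.\<close>
  define A where "A = exp ((M + C + 1) / \<eta>)"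
  have A: "A > 0" by (simp add: A_def)
  obtain B eps where B: "finite B" "0 < eps" "eps < min \<eta> (1 / (2 * A))" "eps * card B < min \<eta> (1 / (2 * A))"
    "\<And>x. x \<in> K \<Longrightarrow> \<exists>b\<in>B. \<bar>x - b\<bar> \<le> eps"
    using compact_null_net[OF K, of "min \<eta> (1 / (2 * A))"] \<eta> A by auto
  obtain E where E: "open E" "emeasure lborel E \<le> ennreal (2 * A * (eps * card B))"
    "\<And>x b. b \<in> B \<Longrightarrow> \<bar>x - b\<bar> \<le> eps \<Longrightarrow> ln A \<le> conj_poisson eps (indicator E) x"
    using ln_le_conj_poisson_union[OF B(1,2) A] by blast
  have "2 * A * (eps * card B) \<le> 1" using B(4) A by (simp add: field_simps)
  then have E1: "emeasure lborel E \<le> 1"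
    using E(2) by (metis ennreal_1 ennreal_leI order_trans)
  then have Efin: "emeasure lborel E < \<infinity>" by (metis ennreal_one_less_top infinity_ennreal_def le_less_trans)
  have Eint: "integrable lborel (indicator E :: real \<Rightarrow> real)" using E(1) Efin by simp
  obtain g L1 where g: "L1-lipschitz_on UNIV g" "integrable lborel g"
    "\<And>t. 0 \<le> g t" "\<And>t. g t \<le> indicator E t"
    "(LINT t|lborel. indicat_real E t - g t) < 2 * eps / \<eta>"
    using that by (rule lipschitz_inner_approximation[OF E(1) Efin divide_pos_pos[OF mult_pos_pos[OF zero_less_numeral B(2)] \<eta>]])
  define G where "G t = F t + \<eta> * g t" for t
  show thesis
  proof (rule that[OF _ _ _ _ _ B(2)])
    show "(L + \<eta> * L1)-lipschitz_on UNIV G"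
      unfolding G_def using \<eta> by (intro lipschitz_on_add lip lipschitz_on_cmult_real_nonneg g(1)) auto
    show "integrable lborel G" unfolding G_def using F g(2) by simp
    show "F t \<le> G t" for t unfolding G_def using g(3) \<eta> by simp
    show "G t \<le> F t + \<eta>" for t
    proof -
      have "g t \<le> 1" using g(4)[of t] indicator_le_1[of E t] by (rule order_trans)
      then have "\<eta> * g t \<le> \<eta> * 1" using \<eta> by (intro mult_left_mono) auto
      then show ?thesis by (simp add: G_def)
    qed
    have "(LINT t|lborel. g t) \<le> (LINT t|lborel. indicat_real E t)"
      using g(2,4) Eint by (intro integral_mono) auto
    also have "\<dots> = measure lborel E" using E(1) by simp
    also have "\<dots> \<le> 1" using E1 by (simp add: measure_def enn2real_leI)
    finally have "\<eta> * (LINT t|lborel. g t) \<le> \<eta> * 1" using \<eta> by (intro mult_left_mono) auto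
    then show "(LINT t|lborel. G t - F t) \<le> \<eta>" by (simp add: G_def)
    show "eps \<le> \<eta>" using B(3) by simp
    fix x assume "x \<in> K"
    then obtain b where "b \<in> B" "\<bar>x - b\<bar> \<le> eps" using B(5) by blast
    then have Q: "ln A \<le> conj_poisson eps (indicator E) x" by (rule E(3))
    have "\<bar>conj_poisson eps (\<lambda>t. indicator E t - g t) x\<bar> \<le> (LINT t|lborel. \<bar>indicator E t - g t\<bar>) / (2 * eps)"
      using B(2) Eint g(2) by (intro abs_conj_poisson_le) auto
    also have "(LINT t|lborel. \<bar>indicator E t - g t\<bar>) = (LINT t|lborel. indicat_real E t - g t)"
      using g(4) by (intro Bochner_Integration.integral_cong) auto
    also have "\<dots> / (2 * eps) \<le> (2 * eps / \<eta>) / (2 * eps)"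
      using g(5) B(2) by (intro divide_right_mono) auto
    also have "\<dots> = 1 / \<eta>" using B(2) by simp
    finally have "ln A - 1 / \<eta> \<le> conj_poisson eps g x"
      using Q conj_poisson_diff[OF B(2) Eint g(2), of x] by linarith
    then have "\<eta> * (ln A - 1 / \<eta>) \<le> \<eta> * conj_poisson eps g x" using \<eta> by (intro mult_left_mono) auto
    moreover have "\<eta> * (ln A - 1 / \<eta>) = M + C" using \<eta> by (simp add: A_def field_simps)
    moreover have "\<bar>conj_poisson eps F x\<bar> \<le> C"
      unfolding C_def by (rule conj_poisson_lipschitz_bounded[OF lip F B(2)])
    ultimately show "M \<le> conj_poisson eps G x"
      using conj_poisson_add_scaled[OF B(2) F g(2), of \<eta> x] unfolding G_def by linarith
  qed
qed

section \<open>Summing the perturbations\<close>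

lemma geometrically_dominated_series:
  fixes h :: "nat \<Rightarrow> real \<Rightarrow> real"
  assumes cont: "\<And>i. continuous_on UNIV (h i)" and int: "\<And>i. integrable lborel (h i)"
    and h0: "\<And>i t. 0 \<le> h i t" and h1: "\<And>i t. h i t \<le> (1/2) ^ Suc i"
    and hint: "\<And>i. (LINT t|lborel. h i t) \<le> c * (1/2) ^ Suc i"
  shows "continuous_on UNIV (\<lambda>t. \<Sum>i. h i t)" "integrable lborel (\<lambda>t. \<Sum>i. h i t)"
    "(LINT t|lborel. (\<Sum>i. h i t)) \<le> c" "\<And>t. summable (\<lambda>i. h i t)"
    "\<And>t. 0 \<le> (\<Sum>i. h i t)" "\<And>t. (\<Sum>i. h i t) \<le> 1"
proof -
  have geo: "(\<lambda>i. (1/2::real) ^ Suc i) sums 1" by (rule power_half_series)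
  have cgeo: "(\<lambda>i. c * (1/2::real) ^ Suc i) sums c" using sums_mult[OF geo, of c] by simp
  have sum: "summable (\<lambda>i. h i t)" for t
    using h0 h1 by (intro summable_comparison_test'[OF sums_summable[OF geo]]) auto
  have "uniform_limit UNIV (\<lambda>n t. \<Sum>i<n. h i t) (\<lambda>t. \<Sum>i. h i t) sequentially"
    using h0 h1 by (intro Weierstrass_m_test[OF _ sums_summable[OF geo]]) auto
  then show "continuous_on UNIV (\<lambda>t. \<Sum>i. h i t)"
    by (rule uniform_limit_theorem[rotated]) (auto intro!: always_eventually continuous_on_sum cont)
  have si: "summable (\<lambda>i. LINT t|lborel. norm (h i t))"
    using h0 hint by (intro summable_comparison_test'[OF sums_summable[OF cgeo]]) (auto intro!: integral_nonneg_AE)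
  show "integrable lborel (\<lambda>t. \<Sum>i. h i t)"
    by (rule integrable_suminf[OF int _ si]) (use sum h0 in auto)
  have "(LINT t|lborel. (\<Sum>i. h i t)) = (\<Sum>i. LINT t|lborel. h i t)"
    by (rule integral_suminf[OF int _ si]) (use sum h0 in auto)
  also have "\<dots> \<le> (\<Sum>i. c * (1/2) ^ Suc i)"
    using si h0 by (intro suminf_le hint sums_summable[OF cgeo]) auto
  finally show "(LINT t|lborel. (\<Sum>i. h i t)) \<le> c" using sums_unique[OF cgeo] by simp
  show "summable (\<lambda>i. h i t)" for t by (rule sum)
  show "0 \<le> (\<Sum>i. h i t)" for t using sum h0 by (intro suminf_nonneg)
  show "(\<Sum>i. h i t) \<le> 1" for t
    using suminf_le[OF h1 sum sums_summable[OF geo]] sums_unique[OF geo] by simp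
qed

theorem theorem2:
  fixes e :: "real set"
  assumes "closed e" and "emeasure lborel e = 0"
  shows "\<exists>f :: real \<Rightarrow> real. continuous_on UNIV f \<and> integrable lborel f \<and>
           (\<forall>x\<in>e. max_hilbert f x = \<infinity>)"
proof -
  define K where "K n = e \<inter> {- real n..real n}" for n
  have K: "compact (K n)" "emeasure lborel (K n) = 0" for n
  proof -
    show "compact (K n)" unfolding K_def using assms(1) by (intro closed_Int_compact) auto
    have "emeasure lborel (K n) \<le> emeasure lborel e"
      unfolding K_def using assms(1) by (intro emeasure_mono) auto
    then show "emeasure lborel (K n) = 0" using assms(2) by simp
  qed
  \<comment> \<open>The state after \<open>n\<close> steps is the current function and scale. The integral of the next increment is bounded
      by the current scale, so that all later increments together are harmless at that scale.\<close>
  have "\<exists>s. \<forall>n. ((\<exists>L. L-lipschitz_on UNIV (fst (s n))) \<and> integrable lborel (fst (s n)) \<and>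
                0 < snd (s n) \<and> snd (s n) \<le> 1 \<and> (n = 0 \<longrightarrow> fst (s n) = (\<lambda>_. 0))) \<and>
        ((\<forall>t. fst (s n) t \<le> fst (s (Suc n)) t \<and> fst (s (Suc n)) t \<le> fst (s n) t + (1/2) ^ Suc n) \<and>
           (LINT t|lborel. fst (s (Suc n)) t - fst (s n) t) \<le> snd (s n) * (1/2) ^ Suc n \<and>
           snd (s (Suc n)) \<le> snd (s n) \<and>
           (\<forall>x\<in>K n. real n + 1 \<le> conj_poisson (snd (s (Suc n))) (fst (s (Suc n))) x))"
    (is "\<exists>s. \<forall>n. ?P n (s n) \<and> ?Q n (s n) (s (Suc n))")
  proof (rule dependent_nat_choice)
    have "?P 0 (\<lambda>_. 0, 1)" by (auto intro!: exI[of _ 0] lipschitz_intros)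
    then show "\<exists>x. ?P 0 x" by blast
  next
    fix s :: "(real \<Rightarrow> real) \<times> real" and n
    assume s: "?P n s"
    obtain F d where sF: "s = (F, d)" by (cases s)
    obtain L where L: "L-lipschitz_on UNIV F" using s sF by auto
    have d: "0 < d" "d \<le> 1" and F: "integrable lborel F" using s sF by auto
    define \<eta> where "\<eta> = d * (1/2) ^ Suc n"
    have \<eta>: "\<eta> > 0" using d by (simp add: \<eta>_def)
    have "\<eta> \<le> 1 * (1/2) ^ Suc n" unfolding \<eta>_def using d by (intro mult_right_mono) auto
    then have \<eta>1: "\<eta> \<le> (1/2) ^ Suc n" by simp
    have "\<eta> \<le> d * 1" unfolding \<eta>_def using d by (intro mult_left_mono power_le_one) auto
    then have \<eta>d: "\<eta> \<le> d" by simp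
    obtain G L' eps where G: "L'-lipschitz_on UNIV G" "integrable lborel G"
      "\<And>t. F t \<le> G t" "\<And>t. G t \<le> F t + \<eta>" "(LINT t|lborel. G t - F t) \<le> \<eta>"
      "0 < eps" "eps \<le> \<eta>" "\<And>x. x \<in> K n \<Longrightarrow> real n + 1 \<le> conj_poisson eps G x"
      using that by (rule small_perturbation_large_conj_poisson[OF L F K \<eta>])
    have epsd: "eps \<le> d" using G(7) \<eta>d by linarith
    have "G t \<le> F t + (1/2) ^ Suc n" for t using G(4)[of t] \<eta>1 by linarith
    then have "?Q n s (G, eps)"
      unfolding sF fst_conv snd_conv using G(3,8) G(5)[unfolded \<eta>_def] epsd by blast
    moreover have "?P (Suc n) (G, eps)" using G(1,2,6) epsd d(2) by auto
    ultimately show "\<exists>s'. ?P (Suc n) s' \<and> ?Q n s s'" by blast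
  qed
  then obtain s where s: "\<And>n. ?P n (s n)" "\<And>n. ?Q n (s n) (s (Suc n))" by blast
  define F where "F n = fst (s n)" for n
  define d where "d n = snd (s n)" for n
  have lip: "\<exists>L. L-lipschitz_on UNIV (F n)" and Fint: "integrable lborel (F n)"
    and d0: "0 < d n" and d1: "d n \<le> 1" and F0: "F 0 = (\<lambda>_. 0)" for n
    using s(1)[of n] s(1)[of 0] by (auto simp: F_def d_def)
  have dmono: "d (Suc n) \<le> d n"
    and large: "\<And>x. x \<in> K n \<Longrightarrow> real n + 1 \<le> conj_poisson (d (Suc n)) (F (Suc n)) x" for n
    using s(2)[of n] by (auto simp: F_def d_def)
  define h where "h n t = F (Suc n) t - F n t" for n t
  have "F n t \<le> F (Suc n) t" "F (Suc n) t \<le> F n t + (1/2) ^ Suc n"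
    "(LINT t|lborel. F (Suc n) t - F n t) \<le> d n * (1/2) ^ Suc n" for n t
    unfolding F_def d_def using s(2)[of n] by blast+
  then have h0: "0 \<le> h n t" and h1: "h n t \<le> (1/2) ^ Suc n"
    and hd: "(LINT t|lborel. h n t) \<le> d n * (1/2) ^ Suc n" for n t
    by (simp_all only: h_def diff_ge_0_iff_ge diff_le_eq add.commute)
  have hcont: "continuous_on UNIV (h n)" for n
    unfolding h_def using lip by (metis continuous_on_diff lipschitz_on_continuous_on)
  have hint: "integrable lborel (h n)" for n unfolding h_def using Fint by simp
  have dle: "d m \<le> d n" if "n \<le> m" for m n using that dmono by (rule lift_Suc_antimono_le[rotated])
  define f where "f t = (\<Sum>i. h i t)" for t
  have "(LINT t|lborel. h n t) \<le> 1 * (1/2) ^ Suc n" for n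
    by (rule order_trans[OF hd mult_right_mono[OF d1]]) simp
  note ser = geometrically_dominated_series[OF hcont hint h0 h1 this]
  have fcont: "continuous_on UNIV f" and fint: "integrable lborel f" and fbd: "\<bar>f t\<bar> \<le> 1" for t
    unfolding f_def using ser by auto
  \<comment> \<open>Everything added after step \<open>m\<close> has integral at most \<open>d m\<close>, hence changes the conjugate Poisson integral
      at scale \<open>d m\<close> by at most 1/2.\<close>
  have tail: "(LINT t|lborel. \<bar>f t - F m t\<bar>) \<le> d m" for m
  proof -
    define h' where "h' i t = h (i + m) t" for i t
    have pw: "(1/2::real) ^ Suc (i + m) \<le> (1/2) ^ Suc i" for i by (intro power_decreasing) auto
    have "f t - F m t = (\<Sum>i. h' i t)" for t
    proof -
      have "F m t = (\<Sum>i<m. h i t)" 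
        unfolding h_def using F0 sum_lessThan_telescope[of "\<lambda>i. F i t" m] by simp
      then show ?thesis unfolding f_def h'_def using suminf_minus_initial_segment[OF ser(4)] by simp
    qed
    moreover have "0 \<le> (\<Sum>i. h' i t)" for t
      unfolding h'_def using ser(4) h0
      by (intro suminf_nonneg summable_ignore_initial_segment)
    moreover have "(LINT t|lborel. (\<Sum>i. h' i t)) \<le> d m"
    proof (rule geometrically_dominated_series(3))
      show "h' i t \<le> (1/2) ^ Suc i" for i t
        unfolding h'_def using h1[of "i + m" t] pw[of i] by linarith
      have "d (i + m) * (1/2) ^ Suc (i + m) \<le> d m * (1/2) ^ Suc i" for i
        using dle[of m "i + m"] d0[of m] pw by (intro mult_mono) auto
      then show "(LINT t|lborel. h' i t) \<le> d m * (1/2) ^ Suc i" for i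
        unfolding h'_def using hd[of "i + m"] order_trans by blast
    qed (auto simp: h'_def hcont hint h0)
    ultimately show ?thesis by simp
  qed
  have big: "real n \<le> conj_poisson (d (Suc n)) f x" if "x \<in> K n" for n x
  proof -
    have "\<bar>conj_poisson (d (Suc n)) (\<lambda>t. f t - F (Suc n) t) x\<bar> \<le> (LINT t|lborel. \<bar>f t - F (Suc n) t\<bar>) / (2 * d (Suc n))"
      using d0 fint Fint by (intro abs_conj_poisson_le) auto
    also have "\<dots> \<le> d (Suc n) / (2 * d (Suc n))"
      using tail d0[of "Suc n"] by (intro divide_right_mono) auto
    also have "\<dots> \<le> 1" using d0[of "Suc n"] by simp
    finally show ?thesis
      using large[OF that] conj_poisson_diff[OF d0[of "Suc n"] fint Fint[of "Suc n"], of x] by linarith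
  qed
  have "max_hilbert f x = \<infinity>" if x: "x \<in> e" for x
  proof (rule ccontr)
    assume "max_hilbert f x \<noteq> \<infinity>"
    then obtain r where r: "r \<ge> 0" "max_hilbert f x = ennreal r" by (cases "max_hilbert f x") auto
    obtain n where n: "max \<bar>x\<bar> (pi * r + pi) < real n" using reals_Archimedean2 by blast
    then have "x \<in> K n" using x by (auto simp: K_def)
    have "ennreal \<bar>trunc_hilbert (d (Suc n)) f x\<bar> \<le> max_hilbert f x"
      unfolding max_hilbert_def using d0 by (intro SUP_upper) auto
    then have "\<bar>trunc_hilbert (d (Suc n)) f x\<bar> \<le> r" using r by (simp add: ennreal_le_iff)
    then have "pi * trunc_hilbert (d (Suc n)) f x \<le> pi * r" by (intro mult_left_mono) auto
    then show False
      using big[OF \<open>x \<in> K n\<close>] n trunc_hilbert_conj_poisson[OF d0[of "Suc n"] fint fbd, of x] by linarith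
  qed
  then show ?thesis using fcont fint by blast
qed

end
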